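(* For each integer $m\geq 0$, $$\frac{\pi}{2} = \ln\Big (\frac{1}{2}\Big (5F_{2m+1}^2 + \sqrt{5}F_{2m+1}\sqrt{5F_{2m+1}^2+4} + 2 \Big )\Big ) - 4 \sqrt{5} \sum_{n=0}^\infty \frac{1}{4n+3} F_{(2m+1)(4n+3)} \Big (\frac{2}{\sqrt{5}F_{2m+1} + \sqrt{5F_{2m+1}^2+4}}\Big )^{4n+3},$$ where $F_k$ denotes the $k$-th Fibonacci number.
   Context: The Fibonacci numbers are defined by $F_0=0$, $F_1=1$, and $F_{n+2}=F_{n+1}+F_n$ for $n\ge 0$. *)

theory Defs
  imports Complex_Main "HOL-Number_Theory.Fib"
begin

end

theory Submission
  imports Defs "HOL-Analysis.Complex_Transcendental"
begin

text \<open>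
  Put \<open>a = \<phi> ^ (2m+1)\<close>, where \<open>\<phi>\<close> is the golden ratio, and let \<open>t\<close> be the base of the
  powers in the series. Binet's formula gives \<open>\<surd>5 F\<^bsub>(2m+1)k\<^esub> = a^k + a^(-k)\<close> for odd \<open>k\<close>, so
  the series splits into two copies of \<open>\<Sum> x^(4n+3)/(4n+3) = (artanh x - arctan x)/2\<close>, at
  \<open>u = at\<close> and \<open>v = t/a\<close>. Since \<open>1/t - t = a + 1/a\<close>, these satisfy \<open>uv = t\<^sup>2\<close> and
  \<open>u + v = 1 - uv\<close>. Hence \<open>arctan u + arctan v = \<pi>/4\<close>, and \<open>artanh u + artanh v = -ln t\<close>, which
  is half of the logarithm in the formula.
\<close>

text \<open>The series of \<open>ln (1 + x) - ln (1 - x)\<close> keeps only odd powers, each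
  doubled. Subtracting twice the alternating arctan series cancels the exponents
  \<open>4*n+1\<close> and leaves the factor 4 at \<open>4*n+3\<close>; blocks of four and of two
  terms align the two series.\<close>

lemma sums_artanh_minus_arctan:
  fixes x :: real
  assumes "\<bar>x\<bar> < 1"
  shows "(\<lambda>n. x ^ (4*n+3) / real (4*n+3)) sums ((artanh x - arctan x) / 2)"
proof -
  \<comment> \<open>at \<open>n = 0\<close> both fractions have denominator 0, hence value 0\<close>
  let ?L = "\<lambda>n. - ((-x)^n) / real n - (- (x^n) / real n)"
  let ?A = "\<lambda>k. (-1)^k * (1 / real (k*2+1) * x ^ (k*2+1))"
  have "?L sums (ln (1 + x) - ln (1 - x))"
    using sums_diff[OF ln_series'[of x] ln_series'[of "-x"]] assms by simp
  also have "ln (1 + x) - ln (1 - x) = 2 * artanh x"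
    using assms by (simp add: artanh_def ln_div abs_less_iff)
  finally have L: "(\<lambda>n. sum ?L {n*4..<n*4+4}) sums (2 * artanh x)"
    by (rule sums_group) simp
  have "?A sums arctan x"
    using assms by (simp only: arctan_series summable_arctan_series summable_sums order.strict_implies_order)
  then have "(\<lambda>n. sum ?A {n*2..<n*2+2}) sums arctan x"
    by (rule sums_group) simp
  from sums_diff[OF L sums_mult[OF this, of 2]]
  have S: "(\<lambda>n. sum ?L {n*4..<n*4+4} - 2 * sum ?A {n*2..<n*2+2}) sums (2 * artanh x - 2 * arctan x)" .
  have "sum ?L {n*4..<n*4+4} - 2 * sum ?A {n*2..<n*2+2} = 4 * (x ^ (4*n+3) / real (4*n+3))" for n
  proof -
    define p q where "p = 4*n" and "q = 2*n"
    have "even p" "even q" "p = q + q"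
      by (simp_all add: p_def q_def)
    moreover have "{n*4..<n*4+4} = {p, p+1, p+2, p+3}" "{n*2..<n*2+2} = {q, q+1}"
      by (auto simp: p_def q_def)
    ultimately have "sum ?L {n*4..<n*4+4} = 2 * (x^(p+1) / real (p+1)) + 2 * (x^(p+3) / real (p+3))"
      "sum ?A {n*2..<n*2+2} = x^(p+1) / real (p+1) - x^(p+3) / real (p+3)"
      by (simp_all add: eval_nat_numeral)
    then show ?thesis by (simp add: p_def)
  qed
  moreover have "2 * artanh x - 2 * arctan x = 4 * ((artanh x - arctan x) / 2)"
    by simp
  ultimately have "(\<lambda>n. 4 * (x ^ (4*n+3) / real (4*n+3))) sums (4 * ((artanh x - arctan x) / 2))"
    using S by (simp only:)
  then show ?thesis
    by (simp only: sums_mult_iff[of 4] zero_neq_numeral[symmetric] not_False_eq_True)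
qed

text \<open>In Binet's formula the conjugate root is \<open>- (1 / \<phi>)\<close>; as
  \<open>r * k\<close> is odd, its sign turns the difference into a sum.\<close>

lemma fib_odd_multiple:
  fixes a :: real
  assumes "odd r" "odd k" and a: "a = ((1 + sqrt 5) / 2) ^ r"
  shows "sqrt 5 * real (fib (r * k)) = a ^ k + (1 / a) ^ k"
proof -
  define \<phi> :: real where "\<phi> = (1 + sqrt 5) / 2"
  have "1 + sqrt 5 > 0"
    by (simp add: add_pos_pos)
  then have "(1 - sqrt 5) / 2 = - (1 / \<phi>)"
    by (simp add: \<phi>_def field_simps)
  then have "((1 - sqrt 5) / 2) ^ (r * k) = - ((1 / \<phi>) ^ (r * k))"
    using assms(1,2) by simp
  then show ?thesis
    by (simp add: fib_closed_form power_mult power_divide a flip: \<phi>_def)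
qed

text \<open>The tangent of the sum is \<open>(u + v) / (1 - u * v)\<close>, which is 1.\<close>

lemma arctan_add_eq_pi_quarter:
  fixes u v :: real
  assumes "0 < u" "u < 1" "0 < v" "v < 1" "u + v = 1 - u * v"
  shows "arctan u + arctan v = pi / 4"
proof -
  have "u * v < 1"
    using assms mult_strict_mono[of u 1 v 1] by simp
  then show ?thesis
    using assms arctan_add[of u v] by (simp add: arctan_one)
qed

text \<open>The relation makes \<open>(1 + u) * (1 + v)\<close> and \<open>(1 - u) * (1 - v)\<close>
  equal to 2 and \<open>2 * (u * v)\<close>, so their quotient is
  \<open>1 / (u * v)\<close>.\<close>

lemma artanh_add_eq_ln:
  fixes u v :: real
  assumes "0 < u" "u < 1" "0 < v" "v < 1" "u + v = 1 - u * v"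
  shows "artanh u + artanh v = - ln (u * v) / 2"
proof -
  have "(1 + u) * (1 + v) = 2" "(1 - u) * (1 - v) = 2 * (u * v)"
    using assms(5) by (simp_all add: algebra_simps)
  then have "ln (1 + u) + ln (1 + v) = ln 2" "ln (1 - u) + ln (1 - v) = ln 2 + ln (u * v)"
    using assms ln_mult_pos[of "1 + u" "1 + v"] ln_mult_pos[of "1 - u" "1 - v"] ln_mult_pos[of 2 "u * v"]
    by simp_all
  then show ?thesis
    using assms by (simp add: artanh_def ln_div field_simps)
qed

theorem theorem9:
  fixes m :: nat
  shows "summable (\<lambda>n::nat. 1 / real (4 * n + 3) * real (fib ((2 * m + 1) * (4 * n + 3))) *
           (2 / (sqrt 5 * real (fib (2 * m + 1))
                  + sqrt (5 * (real (fib (2 * m + 1)))^2 + 4))) ^ (4 * n + 3)) \<and>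
         pi / 2 =
           ln (1 / 2 * (5 * (real (fib (2 * m + 1)))^2
                 + sqrt 5 * real (fib (2 * m + 1)) * sqrt (5 * (real (fib (2 * m + 1)))^2 + 4)
                 + 2))
           - 4 * sqrt 5 * (\<Sum>n::nat. 1 / real (4 * n + 3) * real (fib ((2 * m + 1) * (4 * n + 3))) *
               (2 / (sqrt 5 * real (fib (2 * m + 1))
                      + sqrt (5 * (real (fib (2 * m + 1)))^2 + 4))) ^ (4 * n + 3))"
proof -
  define F where "F = real (fib (2 * m + 1))"
  define a :: real where "a = ((1 + sqrt 5) / 2) ^ (2 * m + 1)"
  define q where "q = sqrt (5 * F\<^sup>2 + 4)"
  define t where "t = 2 / (sqrt 5 * F + q)"
  define u where "u = a * t"
  define v where "v = t / a"
  have "sqrt 5 > 1"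
    by simp
  then have a: "a > 1"
    unfolding a_def by (intro one_less_power) auto
  have s: "sqrt 5 * F = a + 1 / a"
    using fib_odd_multiple[of "2 * m + 1" 1 a] by (simp add: a_def F_def)
  then have s_pos: "sqrt 5 * F > 0"
    using a by (simp add: add_pos_pos)
  have q2: "q\<^sup>2 = (sqrt 5 * F)\<^sup>2 + 4" and "q > 0"
    unfolding q_def by (simp_all add: power_mult_distrib add_nonneg_pos)
  then have t: "t > 0"
    unfolding t_def using s_pos by simp
  have sq: "sqrt 5 * F + q \<noteq> 0"
    using s_pos \<open>q > 0\<close> by linarith
  then have "(sqrt 5 * F + q) * t = 2"
    unfolding t_def times_divide_eq_right by (rule nonzero_mult_div_cancel_left)
  \<comment> \<open>Rationalising: the conjugate factor gives \<open>2 * t\<close> as a difference,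
    whence a quadratic equation for \<open>t\<close>.\<close>
  moreover have "(sqrt 5 * F + q) * (q - sqrt 5 * F) = 4"
    using q2 by (simp add: algebra_simps power2_eq_square)
  ultimately have "(sqrt 5 * F + q) * (q - sqrt 5 * F) = (sqrt 5 * F + q) * (2 * t)"
    by linarith
  then have "q - sqrt 5 * F = 2 * t"
    using mult_left_cancel[OF sq] by blast
  then have st: "sqrt 5 * F * t = 1 - t\<^sup>2"
    using \<open>(sqrt 5 * F + q) * t = 2\<close> by (simp add: algebra_simps power2_eq_square)
  have uv: "u * v = t\<^sup>2" "u + v = 1 - u * v"
    using st a unfolding s u_def v_def by (simp_all add: power2_eq_square field_simps)
  have pos: "0 < u" "0 < v"
    using a t by (simp_all add: u_def v_def)
  \<comment> \<open>Both are positive with sum \<open>1 - t\<^sup>2 < 1\<close>.\<close>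
  then have lt: "u < 1" "v < 1"
    using uv t by (smt (verit) zero_less_power)+
  have term_eq: "1 / real (4*n+3) * real (fib ((2*m+1) * (4*n+3))) * t ^ (4*n+3)
      = (u ^ (4*n+3) / real (4*n+3) + v ^ (4*n+3) / real (4*n+3)) / sqrt 5" for n
  proof -
    have "sqrt 5 * real (fib ((2*m+1) * (4*n+3))) = a ^ (4*n+3) + (1 / a) ^ (4*n+3)"
      by (rule fib_odd_multiple) (simp_all add: a_def)
    then have "real (fib ((2*m+1) * (4*n+3))) = (a ^ (4*n+3) + (1 / a) ^ (4*n+3)) / sqrt 5"
      by (simp add: field_simps)
    moreover have "u ^ (4*n+3) = a ^ (4*n+3) * t ^ (4*n+3)" "v ^ (4*n+3) = (1 / a) ^ (4*n+3) * t ^ (4*n+3)"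
      by (simp_all add: u_def v_def power_mult_distrib power_divide)
    ultimately show ?thesis
      by (simp add: add_divide_distrib ring_distribs)
  qed
  have "artanh u + artanh v = - ln t"
    using artanh_add_eq_ln[OF pos(1) lt(1) pos(2) lt(2) uv(2)] uv(1) t by (simp add: ln_realpow)
  then have "(artanh u - arctan u) / 2 + (artanh v - arctan v) / 2 = (- ln t - pi / 4) / 2"
    using arctan_add_eq_pi_quarter[OF pos(1) lt(1) pos(2) lt(2) uv(2)] by argo
  then have sums: "(\<lambda>n. 1 / real (4*n+3) * real (fib ((2*m+1) * (4*n+3))) * t ^ (4*n+3))
      sums ((- ln t - pi / 4) / 2 / sqrt 5)"
    unfolding term_eq using sums_divide[OF sums_add[OF sums_artanh_minus_arctan[of u] sums_artanh_minus_arctan[of v]], of "sqrt 5"]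
      pos lt by (simp only: abs_of_pos)
  \<comment> \<open>Since \<open>q\<^sup>2\<close> exceeds \<open>(sqrt 5 * F)\<^sup>2\<close> by 4,
    the argument of the logarithm is a perfect square, namely of \<open>1 / t\<close>.\<close>
  have "1 / 2 * (5 * F\<^sup>2 + sqrt 5 * F * q + 2) = ((sqrt 5 * F + q) / 2)\<^sup>2"
    using q2 by (simp add: power2_eq_square field_simps)
  also have "(sqrt 5 * F + q) / 2 = 1 / t"
    by (simp add: t_def)
  finally have "ln (1 / 2 * (5 * F\<^sup>2 + sqrt 5 * F * q + 2)) = - 2 * ln t"
    using t by (simp add: ln_realpow ln_div power_divide)
  moreover have "4 * sqrt 5 * ((- ln t - pi / 4) / 2 / sqrt 5) = - 2 * ln t - pi / 2"
    by (simp add: field_simps)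
  ultimately show ?thesis
    unfolding F_def[symmetric] q_def[symmetric] t_def[symmetric] sums_unique[OF sums, symmetric]
    using sums_summable[OF sums] by (intro conjI) (assumption | linarith)+
qed

end
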